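(* Let $d\in\mathbb N$. For any $\varepsilon>0$ there exists a constant $C$ (depending only on $d$ and $\varepsilon$) such that for all $N_1,\dots,N_d\in\mathbb N$, the function $$S_{N_1,\dots,N_d}(\mathbf x,t)=\sum_{\mathbf n\in S(N_1,\dots,N_d)}e^{2\pi i\mathbf n\cdot\mathbf x}e^{2\pi i|\mathbf n|^2t},\qquad(\mathbf x,t)\in\mathbb T^d\times\mathbb T,$$ satisfies $$\left\|S_{N_1,\dots,N_d}\right\|_{L^{\frac{2(d+2)}{d}}(\mathbb T^{d+1})}\le C\,(N_1\cdots N_d)^{\frac{d}{2(d+2)}}\,\max\{N_1,\dots,N_d\}^{\frac{d}{d+2}+\varepsilon}.$$
   Context: $\mathbb T=\mathbb R/\mathbb Z$ with normalized Lebesgue measure. $S(N_1,\dots,N_d)=\{\mathbf n=(n_1,\dots,n_d)\in\mathbb Z^d:|n_j|\le N_j\text{ for all }j\in\{1,\dots,d\}\}$ and $|\mathbf n|^2=n_1^2+\cdots+n_d^2$. *)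

theory Defs
  imports "HOL-Analysis.Analysis"
begin

text \<open>
  \<open>\<T> = \<real>/\<int>\<close> is represented by its fundamental domain \<open>[0,1)\<close>: functions on \<open>\<T>\<^sup>d \<times> \<T>\<close> are
  1-periodic functions on \<open>\<real>\<^sup>d \<times> \<real>\<close>, and normalized Lebesgue measure on \<open>\<T>\<^sup>d\<close> and \<open>\<T>\<close> is
  Lebesgue measure on the unit cube. The dimension \<open>d\<close> is \<open>CARD('d)\<close>, so \<open>d \<ge> 1\<close>.
\<close>

definition torus :: "real measure" where
  "torus = restrict_space lborel {0..<1}"

definition torus_vec :: "(real ^ 'd) measure" where
  "torus_vec = restrict_space lborel {x. \<forall>j. x $ j \<in> {0..<1}}"

text \<open>
  The Bochner integral is \<open>0\<close> for non-integrable integrands, so this is the usual \<open>L\<^sup>p\<close> norm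
  only for functions in \<open>L\<^sup>p\<close>; see \<open>integrable_exp_sum_powr\<close> below.
\<close>

definition Lp_norm :: "real \<Rightarrow> 'a measure \<Rightarrow> ('a \<Rightarrow> complex) \<Rightarrow> real" where
  "Lp_norm p M f = (\<integral>z. norm (f z) powr p \<partial>M) powr (1 / p)"

definition freq_box :: "('d \<Rightarrow> nat) \<Rightarrow> (int ^ 'd) set" where
  "freq_box N = {n. \<forall>j. \<bar>n $ j\<bar> \<le> int (N j)}"

definition exp_sum :: "('d::finite \<Rightarrow> nat) \<Rightarrow> real ^ 'd \<Rightarrow> real \<Rightarrow> complex" where
  "exp_sum N x t =
    (\<Sum>n\<in>freq_box N.
        exp (2 * pi * \<i> * complex_of_real (\<Sum>j\<in>UNIV. of_int (n $ j) * x $ j)) *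
        exp (2 * pi * \<i> * complex_of_real (of_int (\<Sum>j\<in>UNIV. (n $ j)\<^sup>2) * t)))"

lemma finite_freq_box: "finite (freq_box (N :: 'd::finite \<Rightarrow> nat))"
proof -
  have "freq_box N \<subseteq> vec_lambda ` (PiE UNIV (\<lambda>j. {- int (N j)..int (N j)}))"
  proof
    fix n assume n: "n \<in> freq_box N"
    have "vec_nth n \<in> PiE UNIV (\<lambda>j. {- int (N j)..int (N j)})"
      using n by (auto simp: freq_box_def abs_le_iff minus_le_iff)
    then show "n \<in> vec_lambda ` (PiE UNIV (\<lambda>j. {- int (N j)..int (N j)}))"
      by (metis imageI vec_nth_inverse)
  qed
  then show ?thesis
    by (rule finite_subset) (intro finite_imageI finite_PiE; simp)
qed

lemma prob_space_torus: "emeasure torus (space torus) = 1"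
  by (simp add: torus_def space_restrict_space emeasure_restrict_space)

lemma torus_vec_cube_borel [measurable]:
  "{x :: real ^ 'd::finite. \<forall>j. x $ j \<in> {0..<1}} \<in> sets borel"
  by measurable

lemma prob_space_torus_vec:
  "emeasure (torus_vec :: (real ^ 'd::finite) measure) (space torus_vec) = 1"
proof -
  let ?Q = "{x :: real ^ 'd. \<forall>j. x $ j \<in> {0..<1}}"
  have sp: "emeasure (torus_vec :: (real ^ 'd) measure) (space torus_vec) = emeasure lborel ?Q"
    by (simp add: torus_vec_def space_restrict_space emeasure_restrict_space del: atLeastLessThan_iff)
  have inner: "(\<Prod>b\<in>(Basis :: (real ^ 'd) set). (1 :: real ^ 'd) \<bullet> b) = 1"
    by (intro prod.neutral) (auto simp: Basis_vec_def inner_axis inner_commute)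
  have le: "\<And>b. b \<in> (Basis :: (real ^ 'd) set) \<Longrightarrow> 0 \<bullet> b \<le> (1 :: real ^ 'd) \<bullet> b"
    by (auto simp: Basis_vec_def inner_axis inner_commute)
  have "emeasure lborel ?Q \<le> emeasure lborel (cbox (0 :: real ^ 'd) 1)"
    by (intro emeasure_mono) (auto simp: mem_box_cart less_imp_le)
  moreover have "emeasure lborel (box (0 :: real ^ 'd) 1) \<le> emeasure lborel ?Q"
    by (intro emeasure_mono) (auto simp: mem_box_cart less_imp_le)
  moreover have "emeasure lborel (cbox (0 :: real ^ 'd) 1) = 1"
    using le inner by (simp add: emeasure_lborel_cbox)
  moreover have "emeasure lborel (box (0 :: real ^ 'd) 1) = 1"
    using le inner by (simp add: emeasure_lborel_box)
  ultimately show ?thesis using sp by simp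
qed

lemma integrable_exp_sum_powr:
  fixes N :: "'d::finite \<Rightarrow> nat"
  assumes "p \<ge> 0"
  shows "integrable (torus_vec \<Otimes>\<^sub>M torus) (\<lambda>(x, t). norm (exp_sum N x t) powr p)"
proof -
  let ?M = "(torus_vec :: (real ^ 'd) measure) \<Otimes>\<^sub>M torus"
  interpret X: finite_measure "torus_vec :: (real ^ 'd) measure"
    by (rule finite_measureI) (simp add: prob_space_torus_vec)
  interpret T: finite_measure torus
    by (rule finite_measureI) (simp add: prob_space_torus)
  interpret P: pair_sigma_finite "torus_vec :: (real ^ 'd) measure" torus ..
  have "finite_measure ?M"
    by (rule finite_measureI)
      (simp add: space_pair_measure T.emeasure_pair_measure_Times
        prob_space_torus_vec prob_space_torus)
  then interpret M: finite_measure ?M .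
  have [measurable]: "id \<in> borel_measurable (torus_vec :: (real ^ 'd) measure)"
    "id \<in> borel_measurable torus"
    by (auto simp: torus_vec_def torus_def id_def intro!: measurable_restrict_space1)
  have fx: "(\<lambda>z. fst z) \<in> borel_measurable ?M"
    using measurable_compose[OF measurable_fst,
        of id "torus_vec :: (real ^ 'd) measure" borel torus] by simp
  have ft: "(\<lambda>z. snd z) \<in> borel_measurable ?M"
    using measurable_compose[OF measurable_snd,
        of id torus borel "torus_vec :: (real ^ 'd) measure"] by simp
  have fx': "(\<lambda>z. fst z $ j) \<in> borel_measurable ?M" for j
    using measurable_compose[OF fx, of "\<lambda>x. x $ j"] by (simp add: borel_measurable_continuous_onI continuous_intros)
  note [measurable] = ft fx'
  have meas: "(\<lambda>z. norm (exp_sum N (fst z) (snd z)) powr p) \<in> borel_measurable ?M"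
    unfolding exp_sum_def by measurable
  have bd: "norm (exp_sum N x t) \<le> card (freq_box N)" for x t
    unfolding exp_sum_def
    by (rule order_trans[OF norm_sum]) (simp add: norm_mult)
  have "integrable ?M (\<lambda>z. norm (exp_sum N (fst z) (snd z)) powr p)"
    by (rule M.integrable_const_bound[of _ "real (card (freq_box N)) powr p"])
      (auto intro!: meas AE_I2 powr_mono2 bd assms)
  then show ?thesis by (simp add: split_def)
qed

end

theory Submission
  imports Defs
begin

text \<open>
  The sum factors into one-dimensional sums \<open>S\<^sub>j(x\<^sub>j, t)\<close>. Write \<open>H = 2 max N\<^sub>j\<close>. Weyl differencing bounds
  \<open>|S\<^sub>j|\<^sup>2\<close>, uniformly in \<open>x\<^sub>j\<close>, by a sum over \<open>h \<le> H\<close> of geometric sums at frequency \<open>2ht\<close>, and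
  each of these is dominated by a combination of Fejer kernels, which has nonnegative Fourier
  coefficients. The resulting majorant \<open>W(t)\<close> serves all \<open>j\<close> at once, so with \<open>p = 2 + 4/d\<close> one has
  \<open>|S|\<^sup>p \<le> W\<^sup>2 |S|\<^sup>2\<close>, and integrating in \<open>x\<close> gives \<open>W\<^sup>2 \<Prod>(2 N\<^sub>j + 1)\<close> by Parseval. Expanding \<open>W\<^sup>2\<close>
  in Fourier series, its integral is controlled by the number of solutions of \<open>h i = k j\<close> with
  variables up to \<open>H\<close>, hence is at most \<open>H\<^sup>2\<close> up to powers of \<open>log H\<close>.
\<close>

section \<open>Geometric sums and their domination by Fejer kernels\<close>

lemma norm_power_minus_one_le:
  fixes z :: complex
  assumes "norm z = 1"
  shows "norm (1 - z ^ a) \<le> real a * norm (1 - z)"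
proof (induction a)
  case 0
  then show ?case by simp
next
  case (Suc a)
  have "1 - z ^ Suc a = (1 - z) + z * (1 - z ^ a)"
    by (simp add: algebra_simps)
  also have "norm \<dots> \<le> norm (1 - z) + norm (z * (1 - z ^ a))"
    by (rule norm_triangle_ineq)
  also have "\<dots> \<le> norm (1 - z) + real a * norm (1 - z)"
    using Suc assms by (simp add: norm_mult)
  finally show ?case by (simp add: algebra_simps)
qed

lemma norm_geometric_sum_le:
  fixes z :: complex
  assumes "norm z = 1" "z \<noteq> 1"
  shows "norm (\<Sum>a<K. z ^ a) \<le> 2 / norm (1 - z)"
proof -
  have "norm (1 - z) * norm (\<Sum>a<K. z ^ a) = norm (1 - z ^ K)"
    by (simp add: one_diff_power_eq norm_mult)
  also have "\<dots> \<le> norm (1::complex) + norm (z ^ K)"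
    by (rule norm_triangle_ineq4)
  finally show ?thesis
    using assms by (simp add: field_simps norm_power)
qed

text \<open>Every term \<open>z ^ a\<close> with \<open>a < L\<close> lies within 1/2 of 1, so there
  is no cancellation.\<close>

lemma norm_geometric_sum_ge:
  fixes z :: complex
  assumes "norm z = 1" "real L * norm (1 - z) \<le> 1 / 2"
  shows "norm (\<Sum>a<L. z ^ a) \<ge> real L / 2"
proof -
  have "norm (of_nat L - (\<Sum>a<L. z ^ a)) = norm (\<Sum>a<L. 1 - z ^ a)"
    by (simp add: sum_subtractf)
  also have "\<dots> \<le> (\<Sum>a<L. 1 / 2)"
  proof (rule sum_norm_le)
    fix a assume "a \<in> {..<L}"
    then have "real a * norm (1 - z) \<le> real L * norm (1 - z)"
      by (intro mult_right_mono) auto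
    then show "norm (1 - z ^ a) \<le> 1 / 2"
      using norm_power_minus_one_le[OF assms(1), of a] assms(2) by linarith
  qed
  finally have "norm (of_nat L - (\<Sum>a<L. z ^ a)) \<le> real L / 2" by simp
  moreover have "norm (of_nat L :: complex) \<le> norm (of_nat L - (\<Sum>a<L. z ^ a)) + norm (\<Sum>a<L. z ^ a)"
    by (metis diff_add_cancel norm_triangle_ineq)
  ultimately show ?thesis by simp
qed

text \<open>Each summand is \<open>1 / L\<close> times the Fejer kernel of length \<open>L\<close>.
  It equals 1 at \<open>z = 1\<close> but has mean only \<open>1 / L\<close> over the circle, so the
  total is \<open>H\<close> at 1 while its mean is \<open>harm H\<close>.\<close>

definition fejer_sum :: "nat \<Rightarrow> complex \<Rightarrow> real" where
  "fejer_sum H z = (\<Sum>L=1..H. (norm (\<Sum>a<L. z ^ a))\<^sup>2 / (real L)\<^sup>2)"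

lemma fejer_sum_nonneg: "fejer_sum H z \<ge> 0"
  unfolding fejer_sum_def by (intro sum_nonneg) auto

lemma fejer_sum_mono: "H \<le> H' \<Longrightarrow> fejer_sum H z \<le> fejer_sum H' z"
  unfolding fejer_sum_def by (intro sum_mono2) auto

lemma fejer_sum_cnj: "fejer_sum H (cnj z) = fejer_sum H z"
proof -
  have "norm (\<Sum>a<L. cnj z ^ a) = norm (\<Sum>a<L. z ^ a)" for L
    by (metis (no_types, lifting) cnj_sum complex_cnj_power complex_mod_cnj sum.cong)
  then show ?thesis by (simp add: fejer_sum_def)
qed

text \<open>With \<open>\<delta> = norm (1 - z)\<close>, the left side is at most both
  \<open>H\<close> and \<open>2 / \<delta>\<close>, while each summand of \<open>fejer_sum\<close>
  with \<open>L\<close> up to \<open>min H (1 / (2 * \<delta>))\<close> is at least 1/4. The two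
  bounds have the same size.\<close>

lemma norm_geometric_sum_le_fejer_sum:
  fixes z :: complex
  assumes z: "norm z = 1" and "K \<le> H"
  shows "norm (\<Sum>a<K. z ^ a) \<le> 32 * fejer_sum H z"
proof (cases "K = 0")
  case True
  then show ?thesis by (simp add: fejer_sum_nonneg)
next
  case False
  define \<delta> where "\<delta> = norm (1 - z)"
  have low: "fejer_sum H z \<ge> real m / 4" if "m \<le> H" "real m * \<delta> \<le> 1 / 2" for m
  proof -
    have "real m / 4 = (\<Sum>L=1..m. 1 / 4)" by simp
    also have "\<dots> \<le> fejer_sum m z"
      unfolding fejer_sum_def
    proof (rule sum_mono)
      fix L assume L: "L \<in> {1..m}"
      then have "real L * \<delta> \<le> real m * \<delta>"
        by (intro mult_right_mono) (auto simp: \<delta>_def)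
      then have "norm (\<Sum>a<L. z ^ a) \<ge> real L / 2"
        using that by (intro norm_geometric_sum_ge z) (auto simp: \<delta>_def)
      then have "(norm (\<Sum>a<L. z ^ a))\<^sup>2 \<ge> (real L / 2)\<^sup>2"
        by (intro power_mono) auto
      then show "1 / 4 \<le> (norm (\<Sum>a<L. z ^ a))\<^sup>2 / (real L)\<^sup>2"
        using L by (simp add: field_simps)
    qed
    also have "\<dots> \<le> fejer_sum H z" using that by (intro fejer_sum_mono)
    finally show ?thesis .
  qed
  have K: "norm (\<Sum>a<K. z ^ a) \<le> real H"
  proof -
    have "norm (\<Sum>a<K. z ^ a) \<le> (\<Sum>a<K. 1)"
      using z by (intro sum_norm_le) (simp add: norm_power)
    then show ?thesis using assms by simp
  qed
  \<comment> \<open>Either all \<open>L \<le> H\<close> contribute 1/4, or \<open>z\<close> is far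
    from 1 and the summand \<open>L = 1\<close> suffices, or about \<open>1 / (2 * \<delta>)\<close>
    summands contribute.\<close>
  consider "real H * \<delta> \<le> 1 / 2" | "\<delta> > 1 / 2" | "real H * \<delta> > 1 / 2" "\<delta> \<le> 1 / 2" by linarith
  then show ?thesis
  proof cases
    case 1
    then show ?thesis using low[of H] K by simp
  next
    case 2
    then have "norm (\<Sum>a<K. z ^ a) \<le> 2 / \<delta>"
      using norm_geometric_sum_le[OF z] unfolding \<delta>_def by fastforce
    also have "\<dots> \<le> 4" using 2 by (simp add: field_simps)
    also have "fejer_sum 1 z = 1" by (simp add: fejer_sum_def)
    then have "4 \<le> 32 * fejer_sum H z"
      using fejer_sum_mono[of 1 H z] False assms by simp
    finally show ?thesis .
  next
    case 3
    from 3(1) have pos: "\<delta> > 0"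
      unfolding \<delta>_def by (cases "z = 1") auto
    define m where "m = nat \<lfloor>1 / (2 * \<delta>)\<rfloor>"
    have m: "real m \<le> 1 / (2 * \<delta>)" "1 / (2 * \<delta>) < real m + 1"
      using pos by (simp_all add: m_def)
    \<comment> \<open>This forces \<open>m \<ge> 1\<close>, hence
      \<open>1 / (2 * \<delta>) < m + 1 \<le> 2 * m\<close>: rounding down costs a factor 2. This
      case determines the constant 32.\<close>
    have ge1: "1 / (2 * \<delta>) \<ge> 1" using 3 pos by (simp add: field_simps)
    then have m1: "real m \<ge> 1" using m
      by (metis add_0 gr0I le_less_trans less_irrefl of_nat_0 of_nat_0_less_iff of_nat_1 of_nat_le_iff One_nat_def Suc_leI)
    have "real m < real H"
      using m(1) 3 pos by (smt (verit) divide_le_eq mult.commute mult_right_mono of_nat_0_le_iff times_divide_eq_right divide_less_eq field_sum_of_halves)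
    then have "real m / 4 \<le> fejer_sum H z"
      using m pos by (intro low) (auto simp: field_simps)
    moreover have "norm (\<Sum>a<K. z ^ a) \<le> 2 / \<delta>"
      using norm_geometric_sum_le[OF z] pos unfolding \<delta>_def by fastforce
    moreover have "2 / \<delta> = 4 * (1 / (2 * \<delta>))" using pos by (simp add: field_simps)
    ultimately show ?thesis using m m1 by linarith
  qed
qed

section \<open>Characters on the circle, orthogonality and Parseval\<close>

definition ex :: "real \<Rightarrow> complex" where "ex s = cis (2 * pi * s)"

lemma norm_ex [simp]: "norm (ex s) = 1"
  by (simp add: ex_def)

lemma ex_add: "ex (s + t) = ex s * ex t"
  by (simp add: ex_def cis_mult ring_distribs)

lemma cnj_ex: "cnj (ex s) = ex (- s)"
  by (simp add: ex_def cis_cnj)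

lemma ex_power: "ex s ^ a = ex (real a * s)"
  unfolding ex_def Complex.DeMoivre by (simp add: mult_ac)

lemma ex_0 [simp]: "ex 0 = 1"
  by (simp add: ex_def)

lemma continuous_on_ex [continuous_intros]:
  "continuous_on A f \<Longrightarrow> continuous_on A (\<lambda>x. ex (f x))"
  unfolding ex_def by (intro continuous_intros)

lemma measurable_torus:
  assumes "continuous_on UNIV (f :: real \<Rightarrow> 'a::topological_space)"
  shows "f \<in> borel_measurable torus"
  unfolding torus_def
  using borel_measurable_continuous_onI[OF assms] by (intro measurable_restrict_space1) auto

interpretation torus: finite_measure torus
  by (rule finite_measureI) (simp add: prob_space_torus)

lemma measure_torus: "measure torus (space torus) = 1"
  by (simp add: measure_def prob_space_torus)

lemma integrable_torus:
  fixes f :: "real \<Rightarrow> 'b::{banach, second_countable_topology}"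
  assumes "continuous_on UNIV f"
  shows "integrable torus f"
proof -
  have "compact (f ` {0..1})"
    using assms by (intro compact_continuous_image) (auto intro: continuous_on_subset)
  then obtain B where B: "\<And>x. x \<in> {0..1} \<Longrightarrow> norm (f x) \<le> B"
    using compact_imp_bounded bounded_iff by (metis imageI)
  show ?thesis
    by (rule torus.integrable_const_bound[of _ B])
      (auto simp: torus_def space_restrict_space intro!: B AE_I2 measurable_torus[OF assms, unfolded torus_def])
qed

lemma integral_torus_ex: "(\<integral>t. ex (of_int m * t) \<partial>torus) = (if m = 0 then 1 else 0)"
proof (cases "m = 0")
  case True
  then show ?thesis by (simp add: measure_torus)
next
  case False
  have "(\<integral>t. ex (of_int m * t) \<partial>torus) = (\<integral>t. indicator {0..<1} t *\<^sub>R ex (of_int m * t) \<partial>lborel)"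
    unfolding torus_def by (rule integral_restrict_space) simp
  \<comment> \<open>The added endpoint is a null set; the fundamental theorem of calculus is applied
    on the closed interval.\<close>
  also have "\<dots> = (\<integral>t. indicator {0..1} t *\<^sub>R ex (of_int m * t) \<partial>lborel)"
    using AE_lborel_singleton[of "1::real"]
    by (intro integral_cong_AE borel_measurable_scaleR)
      (auto simp: indicator_def elim!: eventually_mono
        intro!: borel_measurable_continuous_onI continuous_intros)
  also have "\<dots> = ex (of_int m * 1) / (2 * pi * \<i> * of_int m) - ex (of_int m * 0) / (2 * pi * \<i> * of_int m)"
  proof (rule integral_FTC_atLeastAtMost)
    fix x :: real
    let ?w = "2 * pi * \<i> * of_int m :: complex"
    have "((\<lambda>z. exp (?w * z) / ?w) has_field_derivative exp (?w * x)) (at (complex_of_real x))"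
      using False by (auto intro!: derivative_eq_intros)
    then have "((\<lambda>t. exp (?w * complex_of_real t) / ?w) has_vector_derivative exp (?w * x)) (at x within {0..1})"
      by (rule has_vector_derivative_real_field)
    moreover have "ex (of_int m * t) = exp (?w * t)" for t
      by (simp add: ex_def cis_conv_exp mult_ac)
    ultimately show "((\<lambda>t. ex (of_int m * t) / ?w) has_vector_derivative ex (of_int m * x)) (at x within {0..1})"
      by simp
  qed (auto intro!: continuous_intros)
  also have "ex (of_int m * 1) = 1"
    using cis_multiple_2pi[of "of_int m"] by (simp add: ex_def)
  finally show ?thesis using False by simp
qed

text \<open>After expanding the square, orthogonality leaves the pairs of equal frequency. As
  \<open>\<phi>\<close> may repeat values, the formula gives Parseval for injective
  \<open>\<phi>\<close> and a count of coincidences when all coefficients are 1.\<close>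

lemma integral_torus_norm_sum_squared:
  fixes c :: "'i \<Rightarrow> complex" and \<phi> :: "'i \<Rightarrow> int"
  assumes "finite A"
  shows "complex_of_real (\<integral>t. (norm (\<Sum>i\<in>A. c i * ex (of_int (\<phi> i) * t)))\<^sup>2 \<partial>torus)
    = (\<Sum>i\<in>A. \<Sum>j\<in>A. if \<phi> i = \<phi> j then c i * cnj (c j) else 0)"
proof -
  have eq: "complex_of_real ((norm (\<Sum>i\<in>A. c i * ex (of_int (\<phi> i) * t)))\<^sup>2)
      = (\<Sum>i\<in>A. \<Sum>j\<in>A. c i * cnj (c j) * ex (of_int (\<phi> i - \<phi> j) * t))" for t
  proof -
    have "ex (of_int (\<phi> i) * t) * cnj (ex (of_int (\<phi> j) * t)) = ex (of_int (\<phi> i - \<phi> j) * t)" for i j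
      by (simp add: cnj_ex ring_distribs flip: ex_add)
    then have "c i * ex (of_int (\<phi> i) * t) * cnj (c j * ex (of_int (\<phi> j) * t))
        = c i * cnj (c j) * ex (of_int (\<phi> i - \<phi> j) * t)" for i j
      by (metis (no_types, opaque_lifting) complex_cnj_mult mult.assoc mult.left_commute)
    then show ?thesis
      unfolding complex_norm_square cnj_sum sum_product by (intro sum.cong refl)
  qed
  have "complex_of_real (\<integral>t. (norm (\<Sum>i\<in>A. c i * ex (of_int (\<phi> i) * t)))\<^sup>2 \<partial>torus)
    = (\<integral>t. (\<Sum>i\<in>A. \<Sum>j\<in>A. c i * cnj (c j) * ex (of_int (\<phi> i - \<phi> j) * t)) \<partial>torus)"
    unfolding eq[symmetric] by (rule integral_complex_of_real[symmetric])
  also have "\<dots> = (\<Sum>i\<in>A. \<Sum>j\<in>A. c i * cnj (c j) * (\<integral>t. ex (of_int (\<phi> i - \<phi> j) * t) \<partial>torus))"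
    by (subst Bochner_Integration.integral_sum Bochner_Integration.integral_sum,
        auto intro!: integrable_torus continuous_intros sum.cong)+
  also have "\<dots> = (\<Sum>i\<in>A. \<Sum>j\<in>A. if \<phi> i = \<phi> j then c i * cnj (c j) else 0)"
    unfolding integral_torus_ex by (intro sum.cong refl) simp
  finally show ?thesis .
qed

section \<open>Counting solutions of \<open>h i = k j\<close>\<close>

definition mult_quadruples :: "nat \<Rightarrow> (nat \<times> nat \<times> nat \<times> nat) set" where
  "mult_quadruples H = {(h, k, i, j). h \<in> {1..H} \<and> k \<in> {1..H} \<and> i \<in> {1..H} \<and> j \<in> {1..H} \<and> h * i = k * j}"

text \<open>The halves \<open>b \<le> a\<close> and \<open>a \<le> b\<close> cover the square, with
  the diagonal counted twice. By symmetry each contributes the sum of \<open>a * (1 / a)^2\<close>,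
  which is \<open>harm H\<close>.\<close>

lemma sum_inverse_max_squared_le:
  "(\<Sum>a=1..H. \<Sum>b=1..H. (1 / real (max a b))\<^sup>2) \<le> 2 * harm H"
proof -
  have *: "(\<Sum>a=1..H. \<Sum>b=1..a. (1 / real a)\<^sup>2) = harm H"
    unfolding harm_def by (intro sum.cong refl) (simp add: power2_eq_square field_simps)
  have "(\<Sum>a=1..H. \<Sum>b=1..H. (1 / real (max a b))\<^sup>2)
      \<le> (\<Sum>a=1..H. \<Sum>b=1..H. (if b \<le> a then (1 / real a)\<^sup>2 else 0) + (if a \<le> b then (1 / real b)\<^sup>2 else 0))"
    by (intro sum_mono) (auto simp: max_def)
  also have "\<dots> = (\<Sum>a=1..H. \<Sum>b=1..H. if b \<le> a then (1 / real a)\<^sup>2 else 0)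
      + (\<Sum>b=1..H. \<Sum>a=1..H. if a \<le> b then (1 / real b)\<^sup>2 else 0)"
    unfolding sum.distrib by (subst (2) sum.swap) simp
  also have "\<dots> = 2 * (\<Sum>a=1..H. \<Sum>b=1..H. if b \<le> a then (1 / real a)\<^sup>2 else 0)"
    by simp
  also have "(\<Sum>a=1..H. \<Sum>b=1..H. if b \<le> a then (1 / real a)\<^sup>2 else 0)
      = (\<Sum>a=1..H. \<Sum>b=1..a. (1 / real a)\<^sup>2)"
  proof (rule sum.cong[OF refl])
    fix a assume a: "a \<in> {1..H}"
    have "(\<Sum>b=1..H. if b \<le> a then (1 / real a)\<^sup>2 else 0) = (\<Sum>b\<in>{1..H} \<inter> {b. b \<le> a}. (1 / real a)\<^sup>2)"
      by (subst sum.inter_restrict) auto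
    also have "\<dots> = (\<Sum>b=1..a. (1 / real a)\<^sup>2)" using a by (intro sum.cong) auto
    finally show "(\<Sum>b=1..H. if b \<le> a then (1 / real a)\<^sup>2 else 0) = (\<Sum>b=1..a. (1 / real a)\<^sup>2)" .
  qed
  finally show ?thesis using * by simp
qed

text \<open>
  A solution of \<open>h i = k j\<close> factors as \<open>h = g a\<close>, \<open>k = g b\<close>, \<open>i = b c\<close>, \<open>j = a c\<close>, and for given
  \<open>a, b\<close> there are at most \<open>H / max a b\<close> choices for each of \<open>g\<close> and \<open>c\<close>.
\<close>

lemma card_mult_quadruples_le: "real (card (mult_quadruples H)) \<le> 2 * (real H)\<^sup>2 * harm H"
proof -
  define P where "P = Sigma ({1..H} \<times> {1..H}) (\<lambda>(a, b). {1..H div max a b} \<times> {1..H div max a b})"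
  define f where "f = (\<lambda>((a, b), (g, c)). (g * a, g * b, b * c, a * c :: nat))"
  have finP: "finite P" unfolding P_def by auto
  have "mult_quadruples H \<subseteq> f ` P"
  proof
    fix q assume "q \<in> mult_quadruples H"
    then obtain h k i j where q: "q = (h, k, i, j)"
      and r: "h \<in> {1..H}" "k \<in> {1..H}" "i \<in> {1..H}" "j \<in> {1..H}" and eq: "h * i = k * j"
      by (auto simp: mult_quadruples_def)
    define g where "g = gcd h k"
    obtain a b where ab: "h = g * a" "k = g * b" "coprime a b"
      using gcd_coprime_exists[of h k] r unfolding g_def by (auto simp: mult.commute)
    have g: "g > 0" using r by (simp add: g_def)
    have eq': "a * i = b * j" using eq g unfolding ab by (simp add: mult.assoc)
    then have "b dvd i" using ab(3)
      by (metis coprime_commute coprime_dvd_mult_right_iff dvd_triv_left)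
    then obtain c where c: "i = b * c" by blast
    have pos: "a \<ge> 1" "b \<ge> 1" "c \<ge> 1" using r ab c by (auto intro: Suc_leI gr0I)
    have j: "j = a * c" using eq' c pos by (simp add: mult.left_commute)
    have "g * max a b \<le> H" "c * max a b \<le> H"
      using r ab c j by (auto simp: max_def mult.commute)
    then have "g \<in> {1..H div max a b}" "c \<in> {1..H div max a b}"
      using g pos by (auto simp: less_eq_div_iff_mult_less_eq max_def)
    moreover have "a \<le> H" "b \<le> H" using r(3,4) c j pos
      by (metis atLeastAtMost_iff dual_order.trans mult.right_neutral mult_le_mono2 le_refl)+
    ultimately have "((a, b), (g, c)) \<in> P" using pos by (auto simp: P_def)
    moreover have "q = f ((a, b), (g, c))" by (simp add: f_def q ab c j)
    ultimately show "q \<in> f ` P" by blast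
  qed
  then have "card (mult_quadruples H) \<le> card P"
    using finP by (meson card_image_le card_mono finite_imageI le_trans)
  also have "card P = (\<Sum>a=1..H. \<Sum>b=1..H. (H div max a b)\<^sup>2)"
    unfolding P_def by (subst card_SigmaI) (auto simp: sum.cartesian_product power2_eq_square intro!: sum.cong)
  finally have "real (card (mult_quadruples H)) \<le> (\<Sum>a=1..H. \<Sum>b=1..H. (real (H div max a b))\<^sup>2)"
    by (simp flip: of_nat_sum of_nat_power)
  also have "\<dots> \<le> (\<Sum>a=1..H. \<Sum>b=1..H. (real H)\<^sup>2 * (1 / real (max a b))\<^sup>2)"
  proof (intro sum_mono)
    fix a b
    have "(real (H div max a b))\<^sup>2 \<le> (real H / real (max a b))\<^sup>2"
      by (intro power_mono of_nat_div_le_of_nat) auto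
    then show "(real (H div max a b))\<^sup>2 \<le> (real H)\<^sup>2 * (1 / real (max a b))\<^sup>2"
      by (simp add: power_divide)
  qed
  also have "\<dots> = (real H)\<^sup>2 * (\<Sum>a=1..H. \<Sum>b=1..H. (1 / real (max a b))\<^sup>2)"
    by (simp add: sum_distrib_left)
  also have "\<dots> \<le> (real H)\<^sup>2 * (2 * harm H)"
    by (intro mult_left_mono sum_inverse_max_squared_le) auto
  finally show ?thesis by (simp add: mult_ac)
qed

text \<open>The entries model differences of summation indices, the second one taken in the opposite
  order so that the equation carries no sign.\<close>

definition int_pairs :: "nat \<Rightarrow> nat \<Rightarrow> nat \<Rightarrow> (int \<times> int) set" where
  "int_pairs H h k = {(i, j). i \<in> {- int H..int H} \<and> j \<in> {- int H..int H} \<and> int h * i = int k * j}"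

lemma finite_int_pairs: "finite (int_pairs H h k)"
  by (rule finite_subset[of _ "{- int H..int H} \<times> {- int H..int H}"]) (auto simp: int_pairs_def)

text \<open>For \<open>h, k \<ge> 1\<close> a solution is \<open>(0, 0)\<close> or has two entries
  of the same sign, so there are at most \<open>1 + 2 * card (Q h k)\<close> of them. The ones add
  up to \<open>H^2\<close>, and the sets \<open>Q h k\<close> together make up
  \<open>mult_quadruples H\<close>.\<close>

lemma sum_card_int_pairs_le:
  "(\<Sum>h=1..H. \<Sum>k=1..H. real (card (int_pairs H h k))) \<le> (real H)\<^sup>2 * (1 + 4 * harm H)"
proof -
  define Q where "Q h k = {(i, j). i \<in> {1..H} \<and> j \<in> {1..H} \<and> h * i = k * j}" for h k :: nat
  have finQ: "finite (Q h k)" for h k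
    by (rule finite_subset[of _ "{1..H} \<times> {1..H}"]) (auto simp: Q_def)
  have "card (int_pairs H h k) \<le> 1 + 2 * card (Q h k)" if "h \<in> {1..H}" "k \<in> {1..H}" for h k
  proof -
    let ?f = "\<lambda>(i, j). (int i, int j)" and ?g = "\<lambda>(i, j). (- int i, - int j)"
    have "int_pairs H h k \<subseteq> insert (0, 0) (?f ` Q h k \<union> ?g ` Q h k)"
    proof
      fix p assume "p \<in> int_pairs H h k"
      then obtain i j where p: "p = (i, j)" "i \<in> {- int H..int H}" "j \<in> {- int H..int H}"
        and eq: "int h * i = int k * j" by (auto simp: int_pairs_def)
      have hk: "int h > 0" "int k > 0" using that by auto
      consider "i = 0" | "i > 0" | "i < 0" by linarith
      then show "p \<in> insert (0, 0) (?f ` Q h k \<union> ?g ` Q h k)"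
      proof cases
        case 1
        then show ?thesis using eq hk p by simp
      next
        case 2
        then have "int k * j > 0" using hk by (simp flip: eq)
        then have j: "j > 0" using hk by (simp add: zero_less_mult_iff)
        have "h * nat i = k * nat j" using arg_cong[OF eq, of nat] 2 j
          by (simp add: nat_mult_distrib)
        then have "(nat i, nat j) \<in> Q h k" using 2 j p by (auto simp: Q_def)
        then have "?f (nat i, nat j) \<in> ?f ` Q h k" by (rule imageI)
        then show ?thesis using 2 j p by simp
      next
        case 3
        have eq2: "int h * (- i) = int k * (- j)" using eq by simp
        have "int k * (- j) > 0" unfolding eq2[symmetric] using 3 hk by (intro mult_pos_pos) auto
        then have j: "- j > 0" unfolding zero_less_mult_iff using hk by linarith
        have "h * nat (- i) = k * nat (- j)" using arg_cong[OF eq2, of nat] 3 j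
          by (simp add: nat_mult_distrib del: mult_minus_right)
        then have "(nat (- i), nat (- j)) \<in> Q h k" using 3 j p by (auto simp: Q_def)
        then have "?g (nat (- i), nat (- j)) \<in> ?g ` Q h k" by (rule imageI)
        then show ?thesis using 3 j p by simp
      qed
    qed
    then have "card (int_pairs H h k) \<le> card (insert (0, 0) (?f ` Q h k \<union> ?g ` Q h k))"
      using finQ by (intro card_mono) auto
    also have "\<dots> \<le> Suc (card (?f ` Q h k \<union> ?g ` Q h k))" by (rule card_insert_le_m1) auto
    also have "card (?f ` Q h k \<union> ?g ` Q h k) \<le> card (?f ` Q h k) + card (?g ` Q h k)"
      by (rule card_Un_le)
    also have "\<dots> \<le> card (Q h k) + card (Q h k)" by (intro add_mono card_image_le finQ)
    finally show ?thesis by simp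
  qed
  then have "(\<Sum>h=1..H. \<Sum>k=1..H. card (int_pairs H h k)) \<le> (\<Sum>h=1..H. \<Sum>k=1..H. 1 + 2 * card (Q h k))"
    by (intro sum_mono)
  also have "\<dots> = H\<^sup>2 + 2 * (\<Sum>h=1..H. \<Sum>k=1..H. card (Q h k))"
    unfolding sum.distrib by (simp add: power2_eq_square sum_distrib_left)
  also have "(\<Sum>h=1..H. \<Sum>k=1..H. card (Q h k)) = card (mult_quadruples H)"
  proof -
    have "mult_quadruples H = (\<lambda>((h, k), (i, j)). (h, k, i, j)) ` Sigma ({1..H} \<times> {1..H}) (\<lambda>(h, k). Q h k)"
      by (force simp: mult_quadruples_def Q_def)
    moreover have "inj_on (\<lambda>((h, k), (i, j)). (h, k, i, j)) (Sigma ({1..H} \<times> {1..H}) (\<lambda>(h, k). Q h k))"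
      by (auto simp: inj_on_def)
    ultimately have "card (mult_quadruples H) = card (Sigma ({1..H} \<times> {1..H}) (\<lambda>(h, k). Q h k))"
      by (simp add: card_image)
    also have "\<dots> = (\<Sum>h=1..H. \<Sum>k=1..H. card (Q h k))"
      using finQ by (subst card_SigmaI) (auto simp: sum.cartesian_product intro!: sum.cong)
    finally show ?thesis by simp
  qed
  finally have "real (\<Sum>h=1..H. \<Sum>k=1..H. card (int_pairs H h k)) \<le> real (H\<^sup>2 + 2 * card (mult_quadruples H))"
    by (rule of_nat_mono)
  then show ?thesis
    using card_mult_quadruples_le[of H] by (simp add: algebra_simps)
qed

text \<open>For \<open>p = (a, a')\<close> and \<open>q = (b, b')\<close> the equation reads
  \<open>h (a - b) = k (b' - a')\<close>. Thus \<open>(p, q)\<close> is determined by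
  \<open>q\<close>, with \<open>L * L'\<close> choices, and an element of
  \<open>int_pairs H h k\<close>.\<close>

lemma card_coincidences_le:
  assumes "L \<le> H" "L' \<le> H"
  shows "card {(p, q) \<in> ({..<L} \<times> {..<L'}) \<times> ({..<L} \<times> {..<L'}).
      h * fst p + k * snd p = h * fst q + k * snd q} \<le> L * L' * card (int_pairs H h k)"
proof -
  let ?S = "{(p, q) \<in> ({..<L} \<times> {..<L'}) \<times> ({..<L} \<times> {..<L'}).
      h * fst p + k * snd p = h * fst q + k * snd q}"
  let ?T = "({..<L} \<times> {..<L'}) \<times> int_pairs H h k"
  \<comment> \<open>Where a sum or difference is negative, \<open>nat\<close> truncates it to 0;
    this is harmless because the image only has to cover \<open>?S\<close>.\<close>
  let ?f = "\<lambda>((b, b'), (i, j)). ((nat (int b + i), nat (int b' - j)), (b, b'))"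
  have "?S \<subseteq> ?f ` ?T"
  proof
    fix x assume "x \<in> ?S"
    then obtain a a' b b' where x: "x = ((a, a'), (b, b'))" "a < L" "a' < L'" "b < L" "b' < L'"
      and eq: "h * a + k * a' = h * b + k * b'" by auto
    have "int h * (int a - int b) = int k * (int b' - int a')"
      using arg_cong[OF eq, of int] by (simp add: algebra_simps)
    then have "((b, b'), (int a - int b, int b' - int a')) \<in> ?T"
      using x assms by (auto simp: int_pairs_def)
    then have "?f ((b, b'), (int a - int b, int b' - int a')) \<in> ?f ` ?T" by (rule imageI)
    then show "x \<in> ?f ` ?T" by (simp add: x)
  qed
  then have "card ?S \<le> card ?T"
    by (meson card_image_le card_mono finite_SigmaI finite_imageI finite_int_pairs finite_lessThan le_trans)
  then show ?thesis by (simp add: card_cartesian_product)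
qed

section \<open>Weyl differencing\<close>

lemma sum_symmetric_interval:
  fixes f :: "nat \<Rightarrow> real"
  shows "(\<Sum>h\<in>{- int H..int H}. f (nat \<bar>h\<bar>)) = f 0 + 2 * (\<Sum>h=1..H. f h)"
proof (induction H)
  case 0
  then show ?case by simp
next
  case (Suc H)
  have "{- int (Suc H)..int (Suc H)} = insert (- int (Suc H)) (insert (int (Suc H)) {- int H..int H})"
    by auto
  then have "(\<Sum>h\<in>{- int (Suc H)..int (Suc H)}. f (nat \<bar>h\<bar>)) = 2 * f (Suc H) + (\<Sum>h\<in>{- int H..int H}. f (nat \<bar>h\<bar>))"
    by (simp add: nat_add_distrib)
  then show ?case using Suc by simp
qed

text \<open>Shifting the interval to start at 0 costs a unimodular factor. For \<open>u < l\<close>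
  both sums are empty, thanks to \<open>nat\<close>.\<close>

lemma norm_sum_ex_int_interval:
  "norm (\<Sum>b\<in>{l..u}. ex (of_int b * s)) = norm (\<Sum>a<nat (u - l + 1). ex s ^ a)"
proof -
  have "(\<Sum>b\<in>{l..u}. ex (of_int b * s)) = (\<Sum>a<nat (u - l + 1). ex (of_int l * s + real a * s))"
    by (rule sum.reindex_bij_witness[of _ "\<lambda>a. l + int a" "\<lambda>b. nat (b - l)"])
      (auto simp: left_diff_distrib)
  also have "\<dots> = (\<Sum>a<nat (u - l + 1). ex (of_int l * s) * ex s ^ a)"
    by (simp only: ex_power ex_add)
  also have "\<dots> = ex (of_int l * s) * (\<Sum>a<nat (u - l + 1). ex s ^ a)"
    by (rule sum_distrib_left[symmetric])
  finally show ?thesis by (simp add: norm_mult)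
qed

text \<open>\<open>H + 1\<close> accounts for the shift \<open>h = 0\<close>, and 64 is twice the
  constant 32 of the Fejer bound, once for each sign of \<open>h\<close>. Neither \<open>x\<close>
  nor the length of the Gauss sum enters.\<close>

definition weyl_majorant :: "nat \<Rightarrow> real \<Rightarrow> real" where
  "weyl_majorant H t = real H + 1 + 64 * (\<Sum>h=1..H. fejer_sum H (ex (real (2 * h) * t)))"

text \<open>Put \<open>a = b + h\<close> in the expanded square. Since
  \<open>a^2 - b^2 = 2 b h + h^2\<close>, for fixed \<open>h\<close> the sum over \<open>b\<close>
  is geometric with ratio \<open>ex (2 h t)\<close>, and \<open>x\<close> survives only in a
  unimodular factor; hence the uniformity in \<open>x\<close>.\<close>

lemma norm_gauss_sum_squared_le:
  assumes "2 * n \<le> H"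
  shows "(norm (\<Sum>a\<in>{- int n..int n}. ex (of_int a * x + of_int (a\<^sup>2) * t)))\<^sup>2 \<le> weyl_majorant H t"
proof -
  define A where "A = {- int n..int n}"
  \<comment> \<open>These are the \<open>b\<close> for which both \<open>b\<close> and
    \<open>b + h\<close> lie in \<open>A\<close>.\<close>
  define I where "I h = {max (- int n) (- int n - h)..min (int n) (int n - h)}" for h
  \<comment> \<open>A shift \<open>h \<noteq> 0\<close> loses at least one index and leaves at most
    \<open>2 * n \<le> H\<close> terms, so the Fejer bound applies. For \<open>h = 0\<close> there
    are \<open>2 * n + 1\<close> terms, bounded trivially.\<close>
  define g where "g k = (if k = 0 then real H + 1 else 32 * fejer_sum H (ex (real (2 * k) * t)))" for k :: nat
  define F where "F h b = ex (of_int h * x + of_int (2 * b * h + h\<^sup>2) * t)" for h b :: int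
  have "complex_of_real ((norm (\<Sum>a\<in>A. ex (of_int a * x + of_int (a\<^sup>2) * t)))\<^sup>2)
      = (\<Sum>(a, b)\<in>A \<times> A. ex (of_int a * x + of_int (a\<^sup>2) * t) * cnj (ex (of_int b * x + of_int (b\<^sup>2) * t)))"
    unfolding complex_norm_square cnj_sum sum_product by (rule sum.cartesian_product)
  also have "\<dots> = (\<Sum>(a, b)\<in>A \<times> A. F (a - b) b)"
    unfolding F_def cnj_ex ex_add[symmetric]
    by (intro sum.cong refl, clarify, intro arg_cong[of _ _ ex]) (simp add: power2_eq_square algebra_simps)
  also have "\<dots> = (\<Sum>(h, b)\<in>Sigma {- int (2 * n)..int (2 * n)} I. F h b)"
    by (rule sum.reindex_bij_witness[of _ "\<lambda>(h, b). (b + h, b)" "\<lambda>(a, b). (a - b, b)"])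
      (auto simp: A_def I_def)
  also have "\<dots> = (\<Sum>h\<in>{- int (2 * n)..int (2 * n)}. \<Sum>b\<in>I h. F h b)"
    by (subst sum.Sigma) (auto simp: I_def)
  finally have expand: "complex_of_real ((norm (\<Sum>a\<in>A. ex (of_int a * x + of_int (a\<^sup>2) * t)))\<^sup>2)
      = (\<Sum>h\<in>{- int (2 * n)..int (2 * n)}. \<Sum>b\<in>I h. F h b)" .
  have "(norm (\<Sum>a\<in>A. ex (of_int a * x + of_int (a\<^sup>2) * t)))\<^sup>2
      = norm (complex_of_real ((norm (\<Sum>a\<in>A. ex (of_int a * x + of_int (a\<^sup>2) * t)))\<^sup>2))"
    by (simp only: norm_of_real abs_power2)
  also have "\<dots> = norm (\<Sum>h\<in>{- int (2 * n)..int (2 * n)}. \<Sum>b\<in>I h. F h b)"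
    by (simp only: expand)
  also have "\<dots> \<le> (\<Sum>h\<in>{- int (2 * n)..int (2 * n)}. g (nat \<bar>h\<bar>))"
  proof (rule sum_norm_le)
    fix h assume h: "h \<in> {- int (2 * n)..int (2 * n)}"
    define K where "K = nat (min (int n) (int n - h) - max (- int n) (- int n - h) + 1)"
    have "(\<Sum>b\<in>I h. F h b) = ex (of_int h * x + of_int (h\<^sup>2) * t) * (\<Sum>b\<in>I h. ex (of_int b * (of_int (2 * h) * t)))"
      unfolding sum_distrib_left F_def ex_add[symmetric]
      by (intro sum.cong refl arg_cong[of _ _ ex]) (simp add: algebra_simps)
    then have eq: "norm (\<Sum>b\<in>I h. F h b) = norm (\<Sum>a<K. ex (of_int (2 * h) * t) ^ a)"
      unfolding I_def K_def norm_sum_ex_int_interval[symmetric] by (simp add: norm_mult)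
    show "norm (\<Sum>b\<in>I h. F h b) \<le> g (nat \<bar>h\<bar>)"
    proof (cases "h = 0")
      case True
      have "norm (\<Sum>b\<in>I h. F h b) \<le> (\<Sum>a<K. 1)"
        unfolding eq by (intro sum_norm_le) (simp add: norm_power)
      then show ?thesis using assms True by (simp add: g_def K_def)
    next
      case False
      then have "K \<le> H" using assms h by (auto simp: K_def)
      then have "norm (\<Sum>b\<in>I h. F h b) \<le> 32 * fejer_sum H (ex (of_int (2 * h) * t))"
        unfolding eq by (intro norm_geometric_sum_le_fejer_sum) auto
      \<comment> \<open>Negative shifts reduce to positive ones by complex conjugation.\<close>
      also have "fejer_sum H (ex (of_int (2 * h) * t)) = fejer_sum H (ex (real (2 * nat \<bar>h\<bar>) * t))"
        using fejer_sum_cnj[of H "ex (of_int (2 * h) * t)"] by (cases "h \<ge> 0") (auto simp: cnj_ex)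
      finally show ?thesis using False by (simp add: g_def)
    qed
  qed
  \<comment> \<open>Adding nonnegative terms removes the dependence on \<open>n\<close>.\<close>
  also have "\<dots> \<le> (\<Sum>h\<in>{- int H..int H}. g (nat \<bar>h\<bar>))"
    using assms by (intro sum_mono2) (auto simp: g_def fejer_sum_nonneg)
  also have "\<dots> = weyl_majorant H t"
    unfolding sum_symmetric_interval by (simp add: g_def weyl_majorant_def sum_distrib_left)
  finally show ?thesis by (simp add: A_def)
qed

section \<open>Mean square of the majorant\<close>

lemma continuous_on_fejer_sum [continuous_intros]:
  "continuous_on A f \<Longrightarrow> continuous_on A (\<lambda>t. fejer_sum H (f t))"
  unfolding fejer_sum_def by (auto intro!: continuous_intros)

lemma continuous_on_weyl_majorant: "continuous_on A (weyl_majorant H)"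
  unfolding weyl_majorant_def by (intro continuous_intros)

text \<open>The product of the two sums is one exponential sum over pairs \<open>(a, a')\<close>
  with frequencies \<open>2 (h a + k a')\<close>, so its mean square counts coincidences among these
  frequencies.\<close>

lemma integral_geometric_sums_le:
  assumes "L \<le> H" "L' \<le> H"
  shows "(\<integral>t. (norm (\<Sum>a<L. ex (real (2 * h) * t) ^ a))\<^sup>2 * (norm (\<Sum>a<L'. ex (real (2 * k) * t) ^ a))\<^sup>2 \<partial>torus)
    \<le> real (L * L' * card (int_pairs H h k))" (is "?I \<le> _")
proof -
  define A where "A = {..<L} \<times> {..<L'}"
  define \<phi> where "\<phi> p = int (2 * (h * fst p + k * snd p))" for p
  have "(norm (\<Sum>a<L. ex (real (2 * h) * t) ^ a))\<^sup>2 * (norm (\<Sum>a<L'. ex (real (2 * k) * t) ^ a))\<^sup>2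
      = (norm (\<Sum>p\<in>A. 1 * ex (of_int (\<phi> p) * t)))\<^sup>2" for t
  proof -
    have "(\<Sum>a<L. ex (real (2 * h) * t) ^ a) * (\<Sum>a<L'. ex (real (2 * k) * t) ^ a)
        = (\<Sum>p\<in>A. ex (real (2 * h) * t) ^ fst p * ex (real (2 * k) * t) ^ snd p)"
      unfolding sum_product sum.cartesian_product A_def by (simp add: split_def)
    also have "\<dots> = (\<Sum>p\<in>A. 1 * ex (of_int (\<phi> p) * t))"
      unfolding ex_power ex_add[symmetric] \<phi>_def
      by (intro sum.cong refl) (simp add: algebra_simps)
    finally show ?thesis by (metis norm_mult power_mult_distrib)
  qed
  then have "complex_of_real ?I = (\<Sum>p\<in>A. \<Sum>q\<in>A. if \<phi> p = \<phi> q then 1 * cnj 1 else 0)"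
    using integral_torus_norm_sum_squared[of A "\<lambda>_. 1" \<phi>] by (simp add: A_def)
  also have "\<dots> = of_nat (card {(p, q) \<in> A \<times> A. \<phi> p = \<phi> q})"
  proof -
    have fin: "finite A" by (simp add: A_def)
    have "(\<Sum>p\<in>A. \<Sum>q\<in>A. if \<phi> p = \<phi> q then 1 * cnj 1 else 0)
        = (\<Sum>x\<in>A \<times> A. if \<phi> (fst x) = \<phi> (snd x) then 1 else (0::complex))"
      unfolding sum.cartesian_product by (simp add: split_def cong: if_cong)
    also have "\<dots> = (\<Sum>x\<in>{x \<in> A \<times> A. \<phi> (fst x) = \<phi> (snd x)}. 1)"
      by (rule sum.inter_filter[symmetric]) (use fin in auto)
    also have "{x \<in> A \<times> A. \<phi> (fst x) = \<phi> (snd x)} = {(p, q) \<in> A \<times> A. \<phi> p = \<phi> q}"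
      by auto
    finally show ?thesis by simp
  qed
  finally have "complex_of_real ?I = complex_of_real (real (card {(p, q) \<in> A \<times> A. \<phi> p = \<phi> q}))"
    by simp
  then have "?I = real (card {(p, q) \<in> A \<times> A. \<phi> p = \<phi> q})"
    by (simp only: of_real_eq_iff)
  also have "{(p, q) \<in> A \<times> A. \<phi> p = \<phi> q}
      = {(p, q) \<in> A \<times> A. h * fst p + k * snd p = h * fst q + k * snd q}"
    unfolding \<phi>_def of_nat_eq_iff by auto
  also have "real (card \<dots>) \<le> real (L * L' * card (int_pairs H h k))"
    unfolding of_nat_le_iff A_def using assms by (rule card_coincidences_le)
  finally show ?thesis .
qed

text \<open>The weights \<open>1 / (L^2 L'^2)\<close> against the bound \<open>L L'\<close> leave
  \<open>1 / (L L')\<close>, which sums to \<open>(harm H)^2\<close>.\<close>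

lemma integral_fejer_sums_le:
  "(\<integral>t. fejer_sum H (ex (real (2 * h) * t)) * fejer_sum H (ex (real (2 * k) * t)) \<partial>torus)
    \<le> (harm H)\<^sup>2 * real (card (int_pairs H h k))"
proof -
  let ?D = "\<lambda>h t L. (norm (\<Sum>a<L. ex (real (2 * h) * t) ^ a))\<^sup>2"
  have "(\<integral>t. fejer_sum H (ex (real (2 * h) * t)) * fejer_sum H (ex (real (2 * k) * t)) \<partial>torus)
    = (\<integral>t. (\<Sum>L=1..H. \<Sum>L'=1..H. (1 / ((real L)\<^sup>2 * (real L')\<^sup>2)) * (?D h t L * ?D k t L')) \<partial>torus)"
    unfolding fejer_sum_def sum_product by (simp add: mult_ac)
  also have "\<dots> = (\<Sum>L=1..H. \<Sum>L'=1..H. (1 / ((real L)\<^sup>2 * (real L')\<^sup>2)) * (\<integral>t. ?D h t L * ?D k t L' \<partial>torus))"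
    by (subst Bochner_Integration.integral_sum Bochner_Integration.integral_mult_right,
        intro integrable_torus continuous_intros; (rule sum.cong refl)+)+
  also have "\<dots> \<le> (\<Sum>L=1..H. \<Sum>L'=1..H. (1 / ((real L)\<^sup>2 * (real L')\<^sup>2)) * real (L * L' * card (int_pairs H h k)))"
    by (intro sum_mono mult_left_mono integral_geometric_sums_le) auto
  also have "\<dots> = (\<Sum>L=1..H. \<Sum>L'=1..H. (inverse (real L) * inverse (real L')) * real (card (int_pairs H h k)))"
    by (intro sum.cong refl) (auto simp: field_simps power2_eq_square)
  also have "\<dots> = (harm H)\<^sup>2 * real (card (int_pairs H h k))"
    unfolding power2_eq_square harm_def sum_product by (simp only: sum_distrib_right)
  finally show ?thesis .
qed

text \<open>Two of the three factors \<open>harm H\<close> come from the Fejer weights, the third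
  from counting \<open>int_pairs\<close> over all \<open>h\<close> and \<open>k\<close>.\<close>

lemma integral_weyl_majorant_squared_le:
  assumes "H \<ge> 1"
  shows "(\<integral>t. (weyl_majorant H t)\<^sup>2 \<partial>torus) \<le> 40968 * (real H)\<^sup>2 * (harm H)^3"
proof -
  let ?F = "\<lambda>h t. fejer_sum H (ex (real (2 * h) * t))"
  have harm: "harm H \<ge> (1::real)"
    using harm_mono[OF assms, where 'a=real] by (simp add: harm_expand)
  then have harm3: "1 \<le> (harm H :: real)^3" "(harm H :: real)\<^sup>2 \<le> (harm H)^3"
    by (auto intro!: power_increasing)
  have "(\<integral>t. (weyl_majorant H t)\<^sup>2 \<partial>torus)
      \<le> (\<integral>t. 2 * (real H + 1)\<^sup>2 + 8192 * (\<Sum>h=1..H. \<Sum>k=1..H. ?F h t * ?F k t) \<partial>torus)"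
  proof (rule integral_mono)
    fix t
    \<comment> \<open>This is \<open>(u + v)^2 \<le> 2 u^2 + 2 v^2\<close>, with
      \<open>8192 = 2 * 64^2\<close>.\<close>
    have "(x + 64 * y)\<^sup>2 \<le> 2 * x\<^sup>2 + 8192 * (y * y)" for x y :: real
      using zero_le_power2[of "x - 64 * y"] by (simp add: power2_eq_square algebra_simps)
    then show "(weyl_majorant H t)\<^sup>2 \<le> 2 * (real H + 1)\<^sup>2 + 8192 * (\<Sum>h=1..H. \<Sum>k=1..H. ?F h t * ?F k t)"
      unfolding weyl_majorant_def sum_product[symmetric] .
  qed (intro integrable_torus continuous_intros continuous_on_weyl_majorant)+
  also have "\<dots> = 2 * (real H + 1)\<^sup>2 + 8192 * (\<Sum>h=1..H. \<Sum>k=1..H. \<integral>t. ?F h t * ?F k t \<partial>torus)"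
  proof -
    have "(\<integral>t. (\<Sum>h=1..H. \<Sum>k=1..H. ?F h t * ?F k t) \<partial>torus) = (\<Sum>h=1..H. \<Sum>k=1..H. \<integral>t. ?F h t * ?F k t \<partial>torus)"
      by (subst Bochner_Integration.integral_sum,
          intro integrable_torus continuous_intros; (rule sum.cong refl)+)+
    then show ?thesis
      by (subst Bochner_Integration.integral_add)
        (auto simp: measure_torus intro!: integrable_torus continuous_intros)
  qed
  also have "\<dots> \<le> 2 * (2 * real H)\<^sup>2 + 8192 * (\<Sum>h=1..H. \<Sum>k=1..H. (harm H)\<^sup>2 * real (card (int_pairs H h k)))"
    using assms by (intro add_mono mult_left_mono sum_mono integral_fejer_sums_le power_mono) auto
  also have "(\<Sum>h=1..H. \<Sum>k=1..H. (harm H)\<^sup>2 * real (card (int_pairs H h k)))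
      = (harm H)\<^sup>2 * (\<Sum>h=1..H. \<Sum>k=1..H. real (card (int_pairs H h k)))"
    by (simp add: sum_distrib_left)
  also have "\<dots> \<le> (harm H)\<^sup>2 * ((real H)\<^sup>2 * (1 + 4 * harm H))"
    by (intro mult_left_mono sum_card_int_pairs_le) auto
  also have "2 * (2 * real H)\<^sup>2 + 8192 * ((harm H)\<^sup>2 * ((real H)\<^sup>2 * (1 + 4 * harm H)))
      = (real H)\<^sup>2 * (8 + 8192 * (harm H)\<^sup>2 + 32768 * (harm H)^3)"
    by (simp add: algebra_simps power2_eq_square power3_eq_cube)
  \<comment> \<open>As \<open>harm H \<ge> 1\<close>, the lower powers are absorbed into the cube:
    \<open>40968 = 8 + 8192 + 32768\<close>.\<close>
  also have "\<dots> \<le> (real H)\<^sup>2 * (40968 * (harm H)^3)"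
    using harm3 by (intro mult_left_mono) auto
  finally show ?thesis by (simp add: mult_ac)
qed

text \<open>\<open>harm n - ln n\<close> decreases from 1, and
  \<open>ln n \<le> n powr \<delta> / \<delta>\<close>. This turns the logarithms into the loss of
  \<open>\<epsilon>\<close> in the exponent.\<close>

lemma harm_le_powr:
  assumes "\<delta> > 0" "n \<ge> 1"
  shows "harm n \<le> (1 + 1 / \<delta>) * real n powr \<delta>"
proof -
  have "harm n - ln (real n) \<le> harm 1 - ln (real 1)"
    using assms by (intro euler_mascheroni_sequence_decreasing) auto
  then have "harm n \<le> 1 + ln (real n)" by (simp add: harm_expand)
  also have "\<dots> \<le> real n powr \<delta> + real n powr \<delta> / \<delta>"
    using assms by (intro add_mono ln_powr_bound ge_one_powr_ge_zero) auto
  finally show ?thesis by (simp add: algebra_simps)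
qed

section \<open>Factorisation over the coordinates and integration in \<open>x\<close>\<close>

lemma nn_integral_torus_vec_prod:
  fixes f :: "'d::finite \<Rightarrow> real \<Rightarrow> ennreal"
  assumes [measurable]: "\<And>j. f j \<in> borel_measurable borel"
  shows "(\<integral>\<^sup>+x. (\<Prod>j\<in>UNIV. f j (x $ j)) \<partial>torus_vec) = (\<Prod>j\<in>UNIV. \<integral>\<^sup>+s. f j s \<partial>torus)"
proof -
  \<comment> \<open>The product formula for \<open>lborel\<close> runs over basis vectors, so
    coordinates are recovered by \<open>axis_index\<close>. The indicator of the cube is split among
    the factors.\<close>
  define g where "g b s = f (axis_index b) s * indicator {0..<1} s" for b :: "real ^ 'd" and s :: real
  have Basis: "(Basis :: (real ^ 'd) set) = (\<lambda>j. axis j 1) ` UNIV"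
    by (auto simp: Basis_vec_def)
  have inj: "inj (\<lambda>j :: 'd. axis j (1::real))"
    by (auto simp: inj_on_def axis_eq_axis)
  have index: "axis_index (axis j (1::real)) = j" for j :: 'd
    by (simp add: axis_index_axis)
  have "(\<integral>\<^sup>+x. (\<Prod>j\<in>UNIV. f j (x $ j)) \<partial>torus_vec)
      = (\<integral>\<^sup>+x. (\<Prod>j\<in>UNIV. f j (x $ j)) * indicator {x :: real ^ 'd. \<forall>j. x $ j \<in> {0..<1}} x \<partial>lborel)"
    unfolding torus_vec_def using torus_vec_cube_borel by (intro nn_integral_restrict_space) simp
  also have "\<dots> = (\<integral>\<^sup>+x. (\<Prod>b\<in>Basis. g b (x \<bullet> b)) \<partial>lborel)"
  proof (intro nn_integral_cong)
    fix x :: "real ^ 'd"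
    have "(\<Prod>b\<in>Basis. g b (x \<bullet> b)) = (\<Prod>j\<in>UNIV. f j (x $ j) * indicator {0..<1} (x $ j))"
      unfolding Basis prod.reindex[OF inj] by (simp add: g_def index inner_axis)
    also have "\<dots> = (\<Prod>j\<in>UNIV. f j (x $ j)) * (\<Prod>j\<in>UNIV. indicator {0..<1} (x $ j))"
      by (rule prod.distrib)
    also have "(\<Prod>j\<in>UNIV. indicator {0..<1} (x $ j)) = (indicator {x :: real ^ 'd. \<forall>j. x $ j \<in> {0..<1}} x :: ennreal)"
      by (cases "\<forall>j. x $ j \<in> {0..<1}") (auto simp: indicator_def)
    finally show "(\<Prod>j\<in>UNIV. f j (x $ j)) * indicator {x :: real ^ 'd. \<forall>j. x $ j \<in> {0..<1}} x
        = (\<Prod>b\<in>Basis. g b (x \<bullet> b))" by simp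
  qed
  also have "\<dots> = (\<Prod>b\<in>Basis. \<integral>\<^sup>+s. g b s \<partial>lborel)"
    by (rule nn_integral_lborel_prod) (simp_all add: g_def)
  also have "\<dots> = (\<Prod>j\<in>UNIV. \<integral>\<^sup>+s. f j s * indicator {0..<1} s \<partial>lborel)"
    unfolding Basis prod.reindex[OF inj] by (simp add: g_def[abs_def] index)
  also have "\<dots> = (\<Prod>j\<in>UNIV. \<integral>\<^sup>+s. f j s \<partial>torus)"
    unfolding torus_def by (intro prod.cong refl nn_integral_restrict_space[symmetric]) simp
  finally show ?thesis .
qed

definition gauss_sum :: "nat \<Rightarrow> real \<Rightarrow> real \<Rightarrow> complex" where
  "gauss_sum n s t = (\<Sum>a\<in>{- int n..int n}. ex (of_int a * s + of_int (a\<^sup>2) * t))"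

lemma ex_sum: "finite A \<Longrightarrow> ex (\<Sum>i\<in>A. f i) = (\<Prod>i\<in>A. ex (f i))"
  by (induction A rule: finite_induct) (auto simp: ex_add)

lemma continuous_on_gauss_sum [continuous_intros]:
  "continuous_on A f \<Longrightarrow> continuous_on A (\<lambda>x. gauss_sum n (f x) t)"
  unfolding gauss_sum_def by (intro continuous_intros)

text \<open>The phase is a sum over coordinates and the frequency box is a product of intervals, so
  distributivity applies.\<close>

lemma exp_sum_eq_prod: "exp_sum N x t = (\<Prod>j\<in>UNIV. gauss_sum (N j) (x $ j) t)"
proof -
  have "exp_sum N x t = (\<Sum>n\<in>freq_box N. \<Prod>j\<in>UNIV. ex (of_int (n $ j) * x $ j + of_int ((n $ j)\<^sup>2) * t))"
    unfolding exp_sum_def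
  proof (rule sum.cong[OF refl])
    fix n
    have "(\<Prod>j\<in>UNIV. ex (of_int (n $ j) * x $ j + of_int ((n $ j)\<^sup>2) * t))
        = ex ((\<Sum>j\<in>UNIV. of_int (n $ j) * x $ j) + of_int (\<Sum>j\<in>UNIV. (n $ j)\<^sup>2) * t)"
      by (simp add: sum.distrib sum_distrib_right flip: ex_sum)
    then show "exp (2 * pi * \<i> * complex_of_real (\<Sum>j\<in>UNIV. of_int (n $ j) * x $ j)) *
        exp (2 * pi * \<i> * complex_of_real (of_int (\<Sum>j\<in>UNIV. (n $ j)\<^sup>2) * t))
        = (\<Prod>j\<in>UNIV. ex (of_int (n $ j) * x $ j + of_int ((n $ j)\<^sup>2) * t))"
      unfolding ex_add by (simp add: ex_def cis_conv_exp mult_ac)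
  qed
  also have "\<dots> = (\<Sum>g\<in>PiE UNIV (\<lambda>j. {- int (N j)..int (N j)}).
      \<Prod>j\<in>UNIV. ex (of_int (g j) * x $ j + of_int ((g j)\<^sup>2) * t))"
    by (rule sum.reindex_bij_witness[of _ "\<lambda>g. \<chi> j. g j" "\<lambda>n j. n $ j"])
      (auto simp: freq_box_def abs_le_iff minus_le_iff PiE_def Pi_def)
  also have "\<dots> = (\<Prod>j\<in>UNIV. gauss_sum (N j) (x $ j) t)"
    unfolding gauss_sum_def by (rule prod_sum_PiE[symmetric]) auto
  finally show ?thesis .
qed

text \<open>For fixed \<open>t\<close> the quadratic phases are unimodular coefficients, so Parseval
  in \<open>s\<close> counts the frequencies.\<close>

lemma nn_integral_gauss_sum_squared:
  "(\<integral>\<^sup>+s. ennreal ((norm (gauss_sum n s t))\<^sup>2) \<partial>torus) = ennreal (2 * real n + 1)"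
proof -
  let ?c = "\<lambda>a::int. ex (of_int (a\<^sup>2) * t)"
  have "complex_of_real (\<integral>s. (norm (gauss_sum n s t))\<^sup>2 \<partial>torus)
      = complex_of_real (\<integral>s. (norm (\<Sum>a\<in>{- int n..int n}. ?c a * ex (of_int a * s)))\<^sup>2 \<partial>torus)"
    unfolding gauss_sum_def ex_add by (simp add: mult.commute)
  also have "\<dots> = (\<Sum>a\<in>{- int n..int n}. \<Sum>b\<in>{- int n..int n}. if a = b then ?c a * cnj (?c b) else 0)"
    by (rule integral_torus_norm_sum_squared) simp
  also have "\<dots> = (\<Sum>a\<in>{- int n..int n}. 1)"
    by (intro sum.cong refl) (simp add: sum.delta complex_norm_square[symmetric])
  also have "\<dots> = complex_of_real (2 * real n + 1)" by simp
  finally have "(\<integral>s. (norm (gauss_sum n s t))\<^sup>2 \<partial>torus) = 2 * real n + 1"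
    by (simp only: of_real_eq_iff)
  moreover have "integrable torus (\<lambda>s. (norm (gauss_sum n s t))\<^sup>2)"
    by (intro integrable_torus continuous_intros)
  ultimately show ?thesis by (subst nn_integral_eq_integral) auto
qed

lemma nn_integral_exp_sum_squared:
  fixes N :: "'d::finite \<Rightarrow> nat"
  shows "(\<integral>\<^sup>+x. ennreal ((norm (exp_sum N x t))\<^sup>2) \<partial>torus_vec) = ennreal (\<Prod>j\<in>UNIV. 2 * real (N j) + 1)"
proof -
  have "(\<integral>\<^sup>+x. ennreal ((norm (exp_sum N x t))\<^sup>2) \<partial>torus_vec)
      = (\<integral>\<^sup>+x. (\<Prod>j\<in>UNIV. ennreal ((norm (gauss_sum (N j) (x $ j) t))\<^sup>2)) \<partial>torus_vec)"
    by (simp add: exp_sum_eq_prod prod_norm[symmetric] prod_power_distrib prod_ennreal)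
  also have "\<dots> = (\<Prod>j\<in>UNIV. \<integral>\<^sup>+s. ennreal ((norm (gauss_sum (N j) s t))\<^sup>2) \<partial>torus)"
    by (rule nn_integral_torus_vec_prod[of "\<lambda>j s. ennreal ((norm (gauss_sum (N j) s t))\<^sup>2)"])
      (intro measurable_compose[OF _ measurable_ennreal] borel_measurable_continuous_onI continuous_intros)
  also have "\<dots> = ennreal (\<Prod>j\<in>UNIV. 2 * real (N j) + 1)"
    unfolding nn_integral_gauss_sum_squared by (rule prod_ennreal) simp
  finally show ?thesis .
qed

section \<open>From the pointwise majorant to the norm estimate\<close>

lemma weyl_majorant_pos: "weyl_majorant H t > 0"
proof -
  have "(\<Sum>h=1..H. fejer_sum H (ex (real (2 * h) * t))) \<ge> 0"
    by (intro sum_nonneg fejer_sum_nonneg)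
  then show ?thesis unfolding weyl_majorant_def by linarith
qed

text \<open>The exponent is \<open>2 + 4 / d\<close>. In the power \<open>4 / d\<close>, each of the
  \<open>d\<close> factors is at most \<open>W powr (2 / d)\<close>, where \<open>W\<close> is the
  majorant, and together they give exactly \<open>W^2\<close>; the remaining square is kept for
  Parseval.\<close>

lemma norm_exp_sum_powr_le:
  fixes N :: "'d::finite \<Rightarrow> nat"
  assumes "\<And>j. 2 * N j \<le> H"
  defines "d \<equiv> real CARD('d)"
  shows "norm (exp_sum N x t) powr (2 * (d + 2) / d) \<le> (weyl_majorant H t)\<^sup>2 * (norm (exp_sum N x t))\<^sup>2"
proof (cases "exp_sum N x t = 0")
  case False
  have d: "d > 0" by (simp add: d_def)
  let ?g = "\<lambda>j. norm (gauss_sum (N j) (x $ j) t)"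
  let ?W = "weyl_majorant H t"
  have S: "norm (exp_sum N x t) = (\<Prod>j\<in>UNIV. ?g j)"
    by (simp add: exp_sum_eq_prod prod_norm)
  then have g: "?g j > 0" for j using False by (auto simp: exp_sum_eq_prod)
  have "norm (exp_sum N x t) powr (4 / d) = (\<Prod>j\<in>UNIV. ?g j powr (4 / d))"
    unfolding S by (rule prod_powr_distrib)
  also have "\<dots> \<le> (\<Prod>j\<in>(UNIV :: 'd set). ?W powr (2 / d))"
  proof (intro prod_mono conjI)
    fix j
    have "?g j powr (4 / d) = ((?g j)\<^sup>2) powr (2 / d)"
      using g[of j] by (simp add: powr_powr flip: powr_numeral)
    also have "\<dots> \<le> ?W powr (2 / d)"
      using norm_gauss_sum_squared_le[OF assms(1)[of j], of "x $ j" t] d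
      by (intro powr_mono2) (auto simp: gauss_sum_def)
    finally show "?g j powr (4 / d) \<le> ?W powr (2 / d)" .
  qed auto
  also have "\<dots> = ?W\<^sup>2"
    using weyl_majorant_pos[of H t] d by (simp add: powr_realpow[symmetric] powr_powr d_def flip: powr_numeral)
  finally have "norm (exp_sum N x t) powr (4 / d) \<le> ?W\<^sup>2" .
  moreover have "2 * (d + 2) / d = 4 / d + 2" using d by (simp add: field_simps)
  then have "norm (exp_sum N x t) powr (2 * (d + 2) / d)
      = norm (exp_sum N x t) powr (4 / d) * (norm (exp_sum N x t))\<^sup>2"
    using False by (simp add: powr_add)
  ultimately show ?thesis by (simp add: mult_right_mono)
qed simp

text \<open>With \<open>t\<close> fixed and the integral over \<open>x\<close> taken first, the
  majorant is a constant and Parseval evaluates what is left.\<close>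

lemma integral_exp_sum_powr_le:
  fixes N :: "'d::finite \<Rightarrow> nat"
  assumes "\<And>j. 2 * N j \<le> H"
  defines "d \<equiv> real CARD('d)"
  shows "(\<integral>z. norm (case z of (x, t) \<Rightarrow> exp_sum N x t) powr (2 * (d + 2) / d) \<partial>(torus_vec \<Otimes>\<^sub>M torus))
    \<le> (\<Prod>j\<in>UNIV. 2 * real (N j) + 1) * (\<integral>t. (weyl_majorant H t)\<^sup>2 \<partial>torus)"
proof -
  define p where "p = 2 * (d + 2) / d"
  define P where "P = (\<Prod>j\<in>UNIV. 2 * real (N j) + 1)"
  have P: "P \<ge> 0" unfolding P_def by (intro prod_nonneg) auto
  have p: "p \<ge> 0" by (simp add: p_def d_def)
  interpret X: finite_measure "torus_vec :: (real ^ 'd) measure"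
    by (rule finite_measureI) (simp add: prob_space_torus_vec)
  interpret pair_sigma_finite "torus_vec :: (real ^ 'd) measure" torus ..
  have "(\<integral>z. norm (case z of (x, t) \<Rightarrow> exp_sum N x t) powr p \<partial>(torus_vec \<Otimes>\<^sub>M torus))
      = (\<integral>t. (\<integral>x. norm (exp_sum N x t) powr p \<partial>torus_vec) \<partial>torus)"
    using integral_snd[OF integrable_exp_sum_powr[OF p, of N]] by (simp add: split_def)
  also have "\<dots> \<le> (\<integral>t. P * (weyl_majorant H t)\<^sup>2 \<partial>torus)"
  proof (rule integral_mono')
    fix t
    let ?W = "weyl_majorant H t"
    have meas: "(\<lambda>x :: real ^ 'd. ennreal ((norm (exp_sum N x t))\<^sup>2)) \<in> borel_measurable torus_vec"
      unfolding torus_vec_def exp_sum_eq_prod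
      by (intro measurable_restrict_space1 measurable_compose[OF _ measurable_ennreal])
        (simp, intro borel_measurable_continuous_onI continuous_intros)
    \<comment> \<open>The comparison is made with nonnegative integrals;
      \<open>integral_real_bounded\<close> carries it back to the Bochner integral.\<close>
    have "(\<integral>\<^sup>+x. ennreal (norm (exp_sum N x t) powr p) \<partial>torus_vec)
        \<le> (\<integral>\<^sup>+x. ennreal (?W\<^sup>2) * ennreal ((norm (exp_sum N x t))\<^sup>2) \<partial>torus_vec)"
      using norm_exp_sum_powr_le[OF assms(1), where 'd='d] unfolding p_def d_def
      by (intro nn_integral_mono) (simp flip: ennreal_mult')
    also have "\<dots> = ennreal (?W\<^sup>2) * ennreal P"
      unfolding P_def nn_integral_exp_sum_squared[of N t, symmetric] by (rule nn_integral_cmult[OF meas])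
    also have "\<dots> = ennreal (P * ?W\<^sup>2)"
      using P by (simp add: ennreal_mult mult.commute)
    finally show "(\<integral>x. norm (exp_sum N x t) powr p \<partial>torus_vec) \<le> P * ?W\<^sup>2"
      using P by (intro integral_real_bounded) auto
  qed (auto intro!: integrable_torus continuous_intros continuous_on_weyl_majorant mult_nonneg_nonneg P)
  also have "\<dots> = P * (\<integral>t. (weyl_majorant H t)\<^sup>2 \<partial>torus)"
    by simp
  finally show ?thesis by (simp add: p_def P_def)
qed

theorem theorem1p3:
  fixes \<epsilon> :: real
  assumes "\<epsilon> > 0"
  shows "\<exists>C::real. \<forall>N :: 'd::finite \<Rightarrow> nat. (\<forall>j. N j \<ge> 1) \<longrightarrow>
    (let d = real CARD('d) in
      Lp_norm (2 * (d + 2) / d) (torus_vec \<Otimes>\<^sub>M torus) (\<lambda>(x, t). exp_sum N x t)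
        \<le> C * (\<Prod>j\<in>UNIV. real (N j)) powr (d / (2 * (d + 2)))
            * real (Max (range N)) powr (d / (d + 2) + \<epsilon>))"
proof -
  define d where "d = real CARD('d)"
  define p where "p = 2 * (d + 2) / d"
  \<comment> \<open>The cube of \<open>harm\<close> then costs
    \<open>M powr (3 * \<delta>) = M powr (\<epsilon> * p)\<close>, which the \<open>p\<close>-th
    root turns into \<open>M powr \<epsilon>\<close>.\<close>
  define \<delta> where "\<delta> = \<epsilon> * p / 3"
  \<comment> \<open>\<open>163872 = 4 * 40968\<close>, the 4 coming from \<open>(2 * M)^2\<close>;
    the power of 2 comes from \<open>(2 * M) powr (3 * \<delta>)\<close>, and that of 3 from
    \<open>2 * N j + 1 \<le> 3 * N j\<close>.\<close>
  define K where "K = 3 ^ CARD('d) * (163872 * ((1 + 1 / \<delta>) ^ 3 * 2 powr (\<epsilon> * p)))"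
  have d: "d > 0" by (simp add: d_def)
  then have p: "p > 0" by (simp add: p_def)
  then have \<delta>: "\<delta> > 0" using assms by (simp add: \<delta>_def)
  then have K: "K \<ge> 0" by (simp add: K_def)
  show ?thesis
  proof (intro exI[of _ "K powr (1 / p)"] allI impI)
    fix N :: "'d \<Rightarrow> nat"
    assume N: "\<forall>j. N j \<ge> 1"
    define M where "M = Max (range N)"
    have le: "N j \<le> M" for j unfolding M_def by (rule Max_ge) auto
    have M: "M \<ge> 1" using N le le_trans by blast
    define P where "P = (\<Prod>j\<in>UNIV. real (N j))"
    have P: "P \<ge> 0" unfolding P_def by (intro prod_nonneg) auto
    define I where "I = (\<integral>z. norm (case z of (x, t) \<Rightarrow> exp_sum N x t) powr p \<partial>(torus_vec \<Otimes>\<^sub>M torus))"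
    have "(harm (2 * M) :: real) ^ 3 \<le> ((1 + 1 / \<delta>) * real (2 * M) powr \<delta>) ^ 3"
      using harm_le_powr[OF \<delta>, of "2 * M"] M by (intro power_mono harm_nonneg) auto
    also have "\<dots> = (1 + 1 / \<delta>) ^ 3 * (2 powr (\<epsilon> * p) * real M powr (\<epsilon> * p))"
      using M by (simp add: power_mult_distrib powr_mult powr_realpow[symmetric] powr_powr \<delta>_def flip: powr_numeral)
    finally have harm: "(harm (2 * M) :: real) ^ 3 \<le> (1 + 1 / \<delta>) ^ 3 * (2 powr (\<epsilon> * p) * real M powr (\<epsilon> * p))" .
    \<comment> \<open>\<open>H = 2 * M\<close> is admissible for all coordinates at once.\<close>
    have "I \<le> (\<Prod>j\<in>UNIV. 2 * real (N j) + 1) * (\<integral>t. (weyl_majorant (2 * M) t)\<^sup>2 \<partial>torus)"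
      unfolding I_def p_def d_def using le by (intro integral_exp_sum_powr_le) simp
    also have "\<dots> \<le> (\<Prod>j\<in>UNIV. 3 * real (N j)) * (40968 * (real (2 * M))\<^sup>2 * (harm (2 * M)) ^ 3)"
      using N M by (intro mult_mono prod_mono prod_nonneg integral_weyl_majorant_squared_le)
        (auto simp: Suc_le_eq intro!: Bochner_Integration.integral_nonneg)
    also have "(\<Prod>j\<in>UNIV. 3 * real (N j)) = 3 ^ CARD('d) * P"
      by (simp add: prod.distrib P_def)
    also have "3 ^ CARD('d) * P * (40968 * (real (2 * M))\<^sup>2 * (harm (2 * M)) ^ 3)
        \<le> 3 ^ CARD('d) * P * (40968 * (real (2 * M))\<^sup>2 * ((1 + 1 / \<delta>) ^ 3 * (2 powr (\<epsilon> * p) * real M powr (\<epsilon> * p))))"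
      using P by (intro mult_left_mono harm) auto
    also have "\<dots> = K * P * ((real M)\<^sup>2 * real M powr (\<epsilon> * p))"
      by (simp add: K_def mult_ac power_mult_distrib)
    also have "(real M)\<^sup>2 * real M powr (\<epsilon> * p) = real M powr (2 + \<epsilon> * p)"
      using M by (simp add: powr_add)
    finally have I: "I \<le> K * P * real M powr (2 + \<epsilon> * p)" .
    have "Lp_norm p (torus_vec \<Otimes>\<^sub>M torus) (\<lambda>(x, t). exp_sum N x t) = I powr (1 / p)"
      by (simp add: Lp_norm_def I_def)
    also have "\<dots> \<le> (K * P * real M powr (2 + \<epsilon> * p)) powr (1 / p)"
      using I p by (intro powr_mono2) (auto simp: I_def intro!: Bochner_Integration.integral_nonneg)
    also have "\<dots> = K powr (1 / p) * P powr (1 / p) * real M powr ((2 + \<epsilon> * p) / p)"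
      using K P by (simp add: powr_mult powr_powr)
    \<comment> \<open>The factor \<open>M^2\<close> contributes \<open>2 / p = d / (d + 2)\<close>
      to the final exponent.\<close>
    also have "1 / p = d / (2 * (d + 2))" by (simp add: p_def)
    also have "(2 + \<epsilon> * p) / p = d / (d + 2) + \<epsilon>"
      using d p by (simp add: add_divide_distrib) (simp add: p_def field_simps)
    finally show "let d = real CARD('d) in
      Lp_norm (2 * (d + 2) / d) (torus_vec \<Otimes>\<^sub>M torus) (\<lambda>(x, t). exp_sum N x t)
        \<le> K powr (1 / p) * (\<Prod>j\<in>UNIV. real (N j)) powr (d / (2 * (d + 2)))
            * real (Max (range N)) powr (d / (d + 2) + \<epsilon>)"
      unfolding Let_def d_def[symmetric] p_def[symmetric] P_def[symmetric] M_def[symmetric]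
      by (simp add: p_def)
  qed
qed

end
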